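(* Let $n \ge 1$ and let $I = I(C_{2n+1}) \subseteq R = K[x_1,\ldots,x_{2n+1}]$ be the edge ideal of the odd cycle $C_{2n+1}$. For every integer $t \ge 1$, let $(L(t))$ be the ideal of $R$ generated by $$L(t) = \{x^{\underline{a}} \mid \deg(x^{\underline{a}}) \ge 2t \text{ and } w_{V'}(x^{\underline{a}}) \ge t \text{ for all minimal vertex covers } V' \text{ of } C_{2n+1}\}.$$ Then $I^t = (L(t))$.
   Context: $K$ is an algebraically closed field. $C_{2n+1}$ is the cycle graph with vertices $x_1,\ldots,x_{2n+1}$ and edges $\{x_j,x_{j+1}\}$ for $1\le j\le 2n$ and $\{x_{2n+1},x_1\}$; vertices are identified with the variables of the polynomial ring. The edge ideal $I(G)$ of a simple graph $G$ is the ideal generated by all products $x_ix_j$ with $\{x_i,x_j\}$ an edge of $G$. A vertex cover of $G$ is a set $V'$ of vertices meeting every edge; it is minimal if it is minimal with respect to inclusion. For a set $V'$ of vertices and a monomial $x^{\underline{a}} = \prod_i x_i^{a_i}$, the vertex weight is $w_{V'}(x^{\underline{a}}) = \sum_{x_i\in V'} a_i$. *)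

theory Defs
  imports
    "HOL-Library.Poly_Mapping"
    "HOL-Computational_Algebra.Polynomial"
    "HOL-Algebra.Ideal_Product"
begin

text \<open>
  An exponent vector on variables of type \<open>'v\<close> is an element of \<open>'v \<Rightarrow>\<^sub>0 nat\<close>, and
  \<open>('v \<Rightarrow>\<^sub>0 nat) \<Rightarrow>\<^sub>0 'k\<close> is the polynomial ring in all the variables of type \<open>'v\<close>.
  Since the number of variables has to vary, the ring \<open>K[x\<^sub>i | i \<in> V]\<close> is the subring of
  the polynomials that involve only variables from \<open>V\<close>; its ideals are ideals of that
  subring and not of the ambient type.
\<close>

definition polynomial_ring :: "'v set \<Rightarrow> (('v \<Rightarrow>\<^sub>0 nat) \<Rightarrow>\<^sub>0 'k::comm_ring_1) ring"
  where "polynomial_ring V =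
    \<lparr> carrier = {p. \<forall>a\<in>Poly_Mapping.keys p. Poly_Mapping.keys a \<subseteq> V},
      mult = (*), one = 1, zero = 0, add = (+) \<rparr>"

definition var :: "'v \<Rightarrow> ('v \<Rightarrow>\<^sub>0 nat) \<Rightarrow>\<^sub>0 'k::comm_ring_1"
  where "var i = Poly_Mapping.single (Poly_Mapping.single i 1) 1"

definition monomial :: "('v \<Rightarrow>\<^sub>0 nat) \<Rightarrow> ('v \<Rightarrow>\<^sub>0 nat) \<Rightarrow>\<^sub>0 'k::comm_ring_1"
  where "monomial a = (\<Prod>i\<in>Poly_Mapping.keys a. var i ^ Poly_Mapping.lookup a i)"

definition total_degree :: "('v \<Rightarrow>\<^sub>0 nat) \<Rightarrow> nat"
  where "total_degree a = (\<Sum>i\<in>Poly_Mapping.keys a. Poly_Mapping.lookup a i)"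

lemma cring_polynomial_ring:
  "cring (polynomial_ring V :: (('v \<Rightarrow>\<^sub>0 nat) \<Rightarrow>\<^sub>0 'k::comm_ring_1) ring)"
proof (rule cringI)
  let ?R = "polynomial_ring V :: (('v \<Rightarrow>\<^sub>0 nat) \<Rightarrow>\<^sub>0 'k) ring"
  have add: "p + q \<in> carrier ?R" if "p \<in> carrier ?R" "q \<in> carrier ?R" for p q
    using that Poly_Mapping.keys_add[of p q] by (auto simp: polynomial_ring_def)
  have mult: "p * q \<in> carrier ?R" if "p \<in> carrier ?R" "q \<in> carrier ?R" for p q
  proof -
    have "Poly_Mapping.keys c \<subseteq> V" if c: "c \<in> Poly_Mapping.keys (p * q)" for c
    proof -
      obtain a b where "c = a + b" "a \<in> Poly_Mapping.keys p" "b \<in> Poly_Mapping.keys q"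
        using c Poly_Mapping.keys_mult[of p q] by blast
      then show ?thesis
        using \<open>p \<in> carrier ?R\<close> \<open>q \<in> carrier ?R\<close> Poly_Mapping.keys_add[of a b]
        by (simp add: polynomial_ring_def) blast
    qed
    then show ?thesis by (simp add: polynomial_ring_def)
  qed
  have zero: "0 \<in> carrier ?R" and one: "1 \<in> carrier ?R"
    by (simp_all add: polynomial_ring_def)
  have uminus: "- p \<in> carrier ?R" if "p \<in> carrier ?R" for p
    using that by (auto simp: polynomial_ring_def in_keys_iff)
  show "abelian_group ?R"
  proof (rule abelian_groupI)
    fix p assume "p \<in> carrier ?R"
    then show "\<exists>q\<in>carrier ?R. q \<oplus>\<^bsub>?R\<^esub> p = \<zero>\<^bsub>?R\<^esub>"
      using uminus[of p] by (intro bexI[of _ "- p"]) (simp_all add: polynomial_ring_def)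
  next
    show "p \<oplus>\<^bsub>?R\<^esub> q \<in> carrier ?R" if "p \<in> carrier ?R" "q \<in> carrier ?R" for p q
      using add[OF that] by (simp add: polynomial_ring_def)
  qed (use zero in \<open>simp_all add: polynomial_ring_def ac_simps\<close>)
  show "comm_monoid ?R"
  proof (rule comm_monoidI)
    show "p \<otimes>\<^bsub>?R\<^esub> q \<in> carrier ?R" if "p \<in> carrier ?R" "q \<in> carrier ?R" for p q
      using mult[OF that] by (simp add: polynomial_ring_def)
  qed (use one in \<open>simp_all add: polynomial_ring_def ac_simps\<close>)
qed (simp add: polynomial_ring_def distrib_right)

lemma monomial_eq_single:
  "(monomial a :: ('v \<Rightarrow>\<^sub>0 nat) \<Rightarrow>\<^sub>0 'k::comm_ring_1) = Poly_Mapping.single a 1"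
proof -
  have power: "(var i :: ('v \<Rightarrow>\<^sub>0 nat) \<Rightarrow>\<^sub>0 'k) ^ k
      = Poly_Mapping.single (Poly_Mapping.single i k) 1" for i k
    by (induction k) (simp_all add: var_def mult_single flip: single_add)
  have prod: "(\<Prod>i\<in>A. Poly_Mapping.single (f i) (1::'k)) = Poly_Mapping.single (\<Sum>i\<in>A. f i) 1"
    if "finite A" for A and f :: "'v \<Rightarrow> 'v \<Rightarrow>\<^sub>0 nat"
    using that by induction (simp_all add: mult_single)
  have "(\<Sum>i\<in>Poly_Mapping.keys a. Poly_Mapping.single i (Poly_Mapping.lookup a i)) = a"
    by (rule poly_mapping_eqI)
      (simp add: lookup_sum lookup_single when_def in_keys_iff)
  then show ?thesis by (simp add: monomial_def power prod)
qed

definition simple_graph :: "'v set \<Rightarrow> 'v set set \<Rightarrow> bool"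
  where "simple_graph V E \<longleftrightarrow> finite V \<and> (\<forall>e\<in>E. e \<subseteq> V \<and> card e = 2)"

definition cycle_vertices :: "nat \<Rightarrow> nat set"
  where "cycle_vertices m = {1..m}"

definition cycle_edges :: "nat \<Rightarrow> nat set set"
  where "cycle_edges m = {{j, j + 1} | j. 1 \<le> j \<and> j < m} \<union> {{m, 1}}"

lemma simple_graph_cycle:
  assumes "m \<ge> 3"
  shows "simple_graph (cycle_vertices m) (cycle_edges m)"
  using assms by (auto simp: simple_graph_def cycle_vertices_def cycle_edges_def card_insert_if)

definition edge_ideal :: "'v set \<Rightarrow> 'v set set \<Rightarrow> (('v \<Rightarrow>\<^sub>0 nat) \<Rightarrow>\<^sub>0 'k::comm_ring_1) set"
  where "edge_ideal V E = Idl\<^bsub>polynomial_ring V\<^esub> {var i * var j | i j. {i, j} \<in> E}"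

definition vertex_cover :: "'v set \<Rightarrow> 'v set set \<Rightarrow> 'v set \<Rightarrow> bool"
  where "vertex_cover V E W \<longleftrightarrow> W \<subseteq> V \<and> (\<forall>e\<in>E. W \<inter> e \<noteq> {})"

definition minimal_vertex_cover :: "'v set \<Rightarrow> 'v set set \<Rightarrow> 'v set \<Rightarrow> bool"
  where "minimal_vertex_cover V E W \<longleftrightarrow>
    vertex_cover V E W \<and> (\<forall>W'. vertex_cover V E W' \<and> W' \<subseteq> W \<longrightarrow> W' = W)"

definition vertex_weight :: "'v set \<Rightarrow> ('v \<Rightarrow>\<^sub>0 nat) \<Rightarrow> nat"
  where "vertex_weight W a = (\<Sum>i\<in>W. Poly_Mapping.lookup a i)"

definition L_set :: "'v set \<Rightarrow> 'v set set \<Rightarrow> nat \<Rightarrow> (('v \<Rightarrow>\<^sub>0 nat) \<Rightarrow>\<^sub>0 'k::comm_ring_1) set"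
  where "L_set V E t = {monomial a | a. Poly_Mapping.keys a \<subseteq> V \<and> total_degree a \<ge> 2 * t \<and>
    (\<forall>W. minimal_vertex_cover V E W \<longrightarrow> vertex_weight W a \<ge> t)}"

end

theory Submission
  imports Defs
begin

text \<open>
  A product of \<open>t\<close> edges dividing \<open>x\<^sup>a\<close> is a multiset of \<open>t\<close> edges in which every vertex \<open>i\<close>
  occurs at most \<open>a\<^sub>i\<close> times. On a path, the greedy choice at an end vertex shows that such a
  multiset exists as soon as all vertex covers have weight at least \<open>t\<close>. The cycle is the path
  \<open>1, \<dots>, m\<close> with the additional edge \<open>{m, 1}\<close>, which is used \<open>k = t - w(W\<^sub>0)\<close> times
  (or \<open>0\<close> times if this is negative), where \<open>W\<^sub>0\<close> is a path cover
  of least weight among those avoiding both \<open>1\<close> and \<open>m\<close>. That the remaining path still has no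
  cover of weight less than \<open>t - k\<close> amounts to \<open>w(W\<^sub>0) + w(W) \<ge> 2t\<close> for the path covers \<open>W\<close>
  containing both ends: either \<open>W\<^sub>0\<close> and \<open>W\<close> can be exchanged beyond some vertex, which gives two
  covers of the cycle, or they partition the vertices, and the degree condition applies.
\<close>

section \<open>Matchings with vertex capacities\<close>

definition path_cover :: "nat \<Rightarrow> nat set \<Rightarrow> bool"
  where "path_cover m W \<longleftrightarrow> W \<subseteq> {1..m} \<and> (\<forall>j. 1 \<le> j \<and> j < m \<longrightarrow> j \<in> W \<or> Suc j \<in> W)"

lemma path_cover_finite: "path_cover m W \<Longrightarrow> finite W"
  unfolding path_cover_def using finite_subset by blast

text \<open>\<open>x i\<close> is the multiplicity of the edge \<open>{i, i + 1}\<close>; the zeros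
  at 0 and m stand for the missing edges beyond the ends. Induction removes the last vertex after
  using its only edge as often as the capacities permit.\<close>

lemma path_matching:
  fixes c :: "nat \<Rightarrow> nat"
  assumes "m \<ge> 1" and "\<And>W. path_cover m W \<Longrightarrow> t \<le> sum c W"
  shows "\<exists>x. x 0 = 0 \<and> x m = 0 \<and> t \<le> sum x {1..<m} \<and> (\<forall>i\<in>{1..m}. x (i - 1) + x i \<le> c i)"
  using assms
proof (induction m arbitrary: c t rule: nat_induct_at_least)
  case base
  have "t \<le> sum c {}" by (rule base) (simp add: path_cover_def)
  then show ?case by (intro exI[of _ "\<lambda>_. 0"]) simp
next
  case (Suc m)
  define k where "k = min (c m) (c (Suc m))"
  define c' where "c' = c(m := c m - k)"
  have "t - k \<le> sum c' W" if W: "path_cover m W" for W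
  proof -
    have fin: "finite W" using path_cover_finite[OF W] .
    have notin: "Suc m \<notin> W" using W by (auto simp: path_cover_def)
    show ?thesis
    proof (cases "m \<in> W")
      case True
      \<comment> \<open>\<open>W\<close> already meets the last edge, and passing to
        \<open>c'\<close> lowers its weight by exactly \<open>k\<close>.\<close>
      then have "path_cover (Suc m) W"
        using W by (auto simp: path_cover_def less_Suc_eq)
      then have "t \<le> sum c W" by (rule Suc.prems)
      also have "\<dots> = c m + sum c (W - {m})" using fin True by (rule sum.remove)
      also have "sum c (W - {m}) = sum c' (W - {m})"
        by (rule sum.cong) (auto simp: c'_def)
      also have "c m + \<dots> = k + sum c' W"
        using sum.remove[OF fin True, of c'] by (simp add: c'_def k_def)
      finally show ?thesis by simp
    next
      case False
      have eq: "sum c' W = sum c W" using False by (intro sum.cong) (auto simp: c'_def)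
      \<comment> \<open>Either end of the last edge may complete \<open>W\<close>; the cheaper one
        costs only \<open>k\<close>.\<close>
      have "path_cover (Suc m) (insert (Suc m) W)" "path_cover (Suc m) (insert m W)"
        using W Suc.hyps by (auto simp: path_cover_def less_Suc_eq)
      then have "t \<le> sum c (insert (Suc m) W)" "t \<le> sum c (insert m W)"
        by (blast intro: Suc.prems)+
      then show ?thesis using fin False notin by (simp add: eq k_def)
    qed
  qed
  then obtain x where x: "x 0 = 0" "x m = 0" "t - k \<le> sum x {1..<m}"
    "\<forall>i\<in>{1..m}. x (i - 1) + x i \<le> c' i"
    using Suc.IH by blast
  \<comment> \<open>Slot \<open>m\<close>, zero in \<open>x\<close>, now belongs to the last edge;
    slot \<open>Suc m\<close> becomes the new zero at the end.\<close>
  define z where "z = x(m := k, Suc m := 0)"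
  have "sum z {1..<Suc m} = sum x {1..<m} + k"
    using Suc.hyps by (simp add: z_def)
  moreover have "z (i - 1) + z i \<le> c i" if "i \<in> {1..Suc m}" for i
  proof -
    consider "i = Suc m" | "i = m" | "1 \<le> i" "i < m" using \<open>i \<in> {1..Suc m}\<close> by fastforce
    then show ?thesis
    proof cases
      case 2
      have "x (m - 1) + x m \<le> c' m" using x(4) Suc.hyps by simp
      moreover have "k \<le> c m" by (simp add: k_def)
      moreover have "m - 1 \<noteq> m" "m - 1 \<noteq> Suc m" using Suc.hyps by auto
      ultimately show ?thesis using 2 x(2) by (simp add: z_def c'_def)
    next
      case 3
      then have "x (i - 1) + x i \<le> c' i" using x(4) by simp
      moreover have "i - 1 \<noteq> m" using 3 by auto
      ultimately show ?thesis using 3 by (simp add: z_def c'_def)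
    qed (simp add: z_def k_def)
  qed
  ultimately show ?case using x(1,3) Suc.hyps
    by (intro exI[of _ z]) (auto simp: z_def)
qed

text \<open>If the tails of \<open>W\<close> and \<open>W'\<close> can be swapped after some vertex,
  each hybrid inherits one end of the path from \<open>W'\<close>, so \<open>cover\<close> applies
  to both, and the total weight is unchanged. Otherwise the two sets are complementary and
  \<open>deg\<close> applies.\<close>

lemma path_covers_exchange:
  fixes c :: "nat \<Rightarrow> nat"
  assumes W: "path_cover m W" "1 \<notin> W" "m \<notin> W"
    and W': "path_cover m W'" "1 \<in> W'" "m \<in> W'"
    and deg: "2 * t \<le> sum c {1..m}"
    and cover: "\<And>U. path_cover m U \<Longrightarrow> 1 \<in> U \<or> m \<in> U \<Longrightarrow> t \<le> sum c U"
  shows "2 * t \<le> sum c W + sum c W'"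
\<comment> \<open>The two disjunctions say that both hybrids still meet \<open>{i, i + 1}\<close>,
  the only edge across the cut.\<close>
proof (cases "\<exists>i. 1 \<le> i \<and> i < m \<and> (i \<in> W \<or> Suc i \<in> W') \<and> (i \<in> W' \<or> Suc i \<in> W)")
  case True
  then obtain i where i: "1 \<le> i" "i < m" "i \<in> W \<or> Suc i \<in> W'" "i \<in> W' \<or> Suc i \<in> W"
    by blast
  define U U' where "U = (W \<inter> {..i}) \<union> (W' - {..i})" and "U' = (W' \<inter> {..i}) \<union> (W - {..i})"
  have exchange: "path_cover m ((A \<inter> {..i}) \<union> (B - {..i}))"
    if "path_cover m A" "path_cover m B" "i \<in> A \<or> Suc i \<in> B" for A B
    unfolding path_cover_def
  proof (intro conjI allI impI)
    show "A \<inter> {..i} \<union> (B - {..i}) \<subseteq> {1..m}" using that by (auto simp: path_cover_def)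
  next
    fix j assume "1 \<le> j \<and> j < m"
    then show "j \<in> A \<inter> {..i} \<union> (B - {..i}) \<or> Suc j \<in> A \<inter> {..i} \<union> (B - {..i})"
      using that by (cases j i rule: linorder_cases) (auto simp: path_cover_def)
  qed
  have "t \<le> sum c U" "t \<le> sum c U'"
    using cover[of U] cover[of U'] exchange i W W' unfolding U_def U'_def by auto
  moreover have "sum c U = sum c (W \<inter> {..i}) + sum c (W' - {..i})"
    and "sum c U' = sum c (W' \<inter> {..i}) + sum c (W - {..i})"
    unfolding U_def U'_def using path_cover_finite W(1) W'(1)
    by (auto intro!: sum.union_disjoint)
  moreover have "sum c W = sum c (W \<inter> {..i}) + sum c (W - {..i})"
    and "sum c W' = sum c (W' \<inter> {..i}) + sum c (W' - {..i})"
    using path_cover_finite W(1) W'(1) by (blast intro: sum.Int_Diff)+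
  ultimately show ?thesis by linarith
next
  case False
  \<comment> \<open>Both sets meet each edge but one of the hybrids misses it, so the vertices lie
    alternately in \<open>W'\<close> and \<open>W\<close>, starting with 1 in
    \<open>W'\<close>.\<close>
  have "j \<in> W' \<longleftrightarrow> j \<notin> W" if "1 \<le> j" "j \<le> m" for j
    using that
  proof (induction j rule: nat_induct_at_least)
    case base
    then show ?case using W(2) W'(2) by simp
  next
    case (Suc j)
    then have "j \<in> W \<or> Suc j \<in> W" "j \<in> W' \<or> Suc j \<in> W'"
      using W(1) W'(1) by (auto simp: path_cover_def)
    moreover have "(j \<notin> W \<and> Suc j \<notin> W') \<or> (j \<notin> W' \<and> Suc j \<notin> W)"
      using False Suc by (meson Suc_le_lessD)
    moreover have "j \<in> W' \<longleftrightarrow> j \<notin> W" using Suc by simp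
    ultimately show ?case by blast
  qed
  then have "W' = {1..m} - W" using W'(1) by (auto simp: path_cover_def)
  moreover have "W \<subseteq> {1..m}" using W(1) by (simp add: path_cover_def)
  ultimately have "sum c W + sum c W' = sum c {1..m}"
    using sum.subset_diff[of W "{1..m}" c] by simp
  with deg show ?thesis by simp
qed

text \<open>\<open>y i\<close> counts the edge from \<open>i\<close> to its cyclic successor; the
  \<open>if\<close> is the cyclic predecessor. Fixing the multiplicity of \<open>{m, 1}\<close>
  leaves a path with smaller capacities at its ends.\<close>

lemma cycle_matching:
  fixes c :: "nat \<Rightarrow> nat"
  assumes m: "m \<ge> 3" and deg: "2 * t \<le> sum c {1..m}"
    and cover: "\<And>U. path_cover m U \<Longrightarrow> 1 \<in> U \<or> m \<in> U \<Longrightarrow> t \<le> sum c U"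
  shows "\<exists>y. t \<le> sum y {1..m} \<and>
    (\<forall>i\<in>{1..m}. y i + y (if i = 1 then m else i - 1) \<le> c i)"
proof -
  define inner where "inner W \<longleftrightarrow> path_cover m W \<and> 1 \<notin> W \<and> m \<notin> W" for W
  have "inner {2..m - 1}" using m by (auto simp: inner_def path_cover_def)
  then obtain W where W: "inner W" and least: "\<And>U. inner U \<Longrightarrow> sum c W \<le> sum c U"
    using ex_has_least_nat[of inner _ "sum c"] by blast
  \<comment> \<open>Covers avoiding both ends keep their weight when the closing edge is used, so
    \<open>t - k\<close> must not exceed their least weight; this is the smallest such
    \<open>k\<close>.\<close>
  define k where "k = t - sum c W"
  have fin: "finite W" using W path_cover_finite by (auto simp: inner_def)
  \<comment> \<open>Adding an end to \<open>W\<close> gives a cover of the cycle. This bounds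
    \<open>k\<close> by both end capacities, so the subtractions in \<open>c'\<close> are not
    truncated.\<close>
  have "path_cover m (insert 1 W)" "path_cover m (insert m W)"
    using W m by (auto simp: inner_def path_cover_def)
  then have "t \<le> sum c (insert 1 W)" "t \<le> sum c (insert m W)"
    by (auto intro!: cover)
  then have k: "k \<le> c 1" "k \<le> c m"
    using fin W by (auto simp: inner_def k_def)
  define c' where "c' = c(1 := c 1 - k, m := c m - k)"
  have weight: "sum c U = sum c' U + (if 1 \<in> U then k else 0) + (if m \<in> U then k else 0)"
    if "finite U" for U
  proof -
    have "sum c U = (\<Sum>i\<in>U. c' i + (if i = 1 then k else 0) + (if i = m then k else 0))"
      using m k by (intro sum.cong) (auto simp: c'_def)
    then show ?thesis using that by (simp add: sum.distrib)
  qed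
  have "t - k \<le> sum c' U" if U: "path_cover m U" for U
  proof -
    have eq: "sum c U = sum c' U + (if 1 \<in> U then k else 0) + (if m \<in> U then k else 0)"
      using weight path_cover_finite[OF U] .
    consider "1 \<notin> U" "m \<notin> U" | "1 \<in> U" "m \<in> U" | "(1 \<in> U) \<noteq> (m \<in> U)" by blast
    then show ?thesis
    proof cases
      case 1
      then show ?thesis using least[of U] U eq by (simp add: inner_def k_def)
    next
      case 2
      \<comment> \<open>Both ends lose \<open>k\<close>, so \<open>t + k \<le> sum c U\<close> is
        needed. For \<open>k > 0\<close> this is the exchange bound; for \<open>k = 0\<close>, where
        the subtraction may be truncated, it is the cover bound.\<close>
      have "2 * t \<le> sum c W + sum c U"
        using W path_covers_exchange[of m W U t c] U 2 deg cover by (simp add: inner_def)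
      moreover have "t \<le> sum c U" using cover U 2 by blast
      ultimately show ?thesis using eq 2 by (simp add: k_def)
    next
      case 3
      then have "t \<le> sum c U" using cover U by blast
      then show ?thesis using eq 3 by (auto split: if_splits)
    qed
  qed
  then obtain x where x: "x 0 = 0" "x m = 0" "t - k \<le> sum x {1..<m}"
    "\<forall>i\<in>{1..m}. x (i - 1) + x i \<le> c' i"
    using path_matching[of m "t - k" c'] m by auto
  \<comment> \<open>Slot \<open>m\<close> is zero in \<open>x\<close> and so is free for the closing
    edge.\<close>
  define y where "y = x(m := k)"
  have "sum y {1..m} = sum y {1..<m} + y m"
    using m by (simp add: sum.last_plus)
  also have "\<dots> = sum x {1..<m} + k" by (simp add: y_def)
  finally have "t \<le> sum y {1..m}" using x(3) by simp
  moreover have "y i + y (if i = 1 then m else i - 1) \<le> c i" if "i \<in> {1..m}" for i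
  proof -
    have *: "x (i - 1) + x i \<le> c' i" using x(4) that by blast
    consider "i = 1" | "i = m" | "i \<noteq> 1" "i \<noteq> m" by blast
    then show ?thesis
    proof cases
      case 1
      then show ?thesis using * x(1) k m by (simp add: y_def c'_def)
    next
      case 2
      moreover have "m - 1 \<noteq> m" using m by simp
      ultimately show ?thesis using * x(2) k m by (simp add: y_def c'_def)
    next
      case 3
      then have "i - 1 \<noteq> m" using that by auto
      with 3 show ?thesis using * by (simp add: y_def c'_def)
    qed
  qed
  ultimately show ?thesis by blast
qed

text \<open>Transfers the weight condition from minimal covers to all covers, since weights grow
  with the set. There are only finitely many covers, so a minimal one exists below
  \<open>W\<close>.\<close>

lemma minimal_vertex_cover_subset:
  assumes "finite V" "vertex_cover V E W"
  obtains W' where "minimal_vertex_cover V E W'" "W' \<subseteq> W"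
proof -
  have "finite {U. vertex_cover V E U}"
    using assms(1) by (rule finite_subset[rotated, OF finite_Pow_iff[THEN iffD2]])
      (auto simp: vertex_cover_def)
  then obtain W' where "vertex_cover V E W'" "W' \<subseteq> W"
    "\<And>U. vertex_cover V E U \<Longrightarrow> U \<subseteq> W' \<Longrightarrow> W' = U"
    using finite_has_minimal2[of "{U. vertex_cover V E U}" W] assms(2) by auto
  then show thesis using that[of W'] by (auto simp: minimal_vertex_cover_def)
qed

section \<open>Powers of ideals\<close>

lemma (in cring) ideal_pow_is_ideal:
  assumes "ideal I R"
  shows "ideal (I [^]\<^bsub>ideals_set R\<^esub> (t::nat)) R"
proof -
  interpret S: comm_monoid "ideals_set R" by (rule ideals_set_is_comm_monoid)
  have "I [^]\<^bsub>ideals_set R\<^esub> t \<in> carrier (ideals_set R)"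
    using assms by (intro S.nat_pow_closed) (simp add: ideals_set_def)
  then show ?thesis by (simp add: ideals_set_def)
qed

text \<open>This is the colon ideal of \<open>J\<close> by \<open>B\<close>. It serves to extend
  membership of products in \<open>J\<close> from generators to whole ideals.\<close>

lemma (in cring) colon_is_ideal:
  assumes J: "ideal J R" and B: "B \<subseteq> carrier R"
  shows "ideal {x \<in> carrier R. \<forall>b\<in>B. x \<otimes> b \<in> J} R"
proof -
  interpret J: ideal J R by (rule J)
  note B' = subsetD[OF B]
  show ?thesis
  proof (rule idealI)
    show "subgroup {x \<in> carrier R. \<forall>b\<in>B. x \<otimes> b \<in> J} (add_monoid R)"
    proof (rule add.subgroupI)
      fix a assume "a \<in> {x \<in> carrier R. \<forall>b\<in>B. x \<otimes> b \<in> J}"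
      then show "\<ominus> a \<in> {x \<in> carrier R. \<forall>b\<in>B. x \<otimes> b \<in> J}"
        using B' by (auto simp: l_minus)
    next
      show "{x \<in> carrier R. \<forall>b\<in>B. x \<otimes> b \<in> J} \<noteq> {}"
        using B' by (auto intro!: exI[of _ \<zero>])
    qed (use B' in \<open>auto simp: l_distr\<close>)
  next
    fix a x assume a: "a \<in> {x \<in> carrier R. \<forall>b\<in>B. x \<otimes> b \<in> J}" and x: "x \<in> carrier R"
    show *: "x \<otimes> a \<in> {x \<in> carrier R. \<forall>b\<in>B. x \<otimes> b \<in> J}"
      using a x B' by (auto simp: m_assoc J.I_l_closed)
    then show "a \<otimes> x \<in> {x \<in> carrier R. \<forall>b\<in>B. x \<otimes> b \<in> J}"
      using a x m_comm by simp
  qed (rule ring_axioms)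
qed

text \<open>Two colon ideals do the work: the one by \<open>B\<close> contains \<open>A\<close>,
  hence \<open>Idl A\<close>; then the one by \<open>Idl A\<close> contains \<open>B\<close>, hence
  \<open>Idl B\<close>.\<close>

lemma (in cring) genideal_prod_subset:
  assumes A: "A \<subseteq> carrier R" and B: "B \<subseteq> carrier R" and J: "ideal J R"
    and prod: "\<And>a b. a \<in> A \<Longrightarrow> b \<in> B \<Longrightarrow> a \<otimes> b \<in> J"
  shows "(Idl A) \<cdot> (Idl B) \<subseteq> J"
proof -
  interpret J: ideal J R by (rule J)
  have *: "a \<otimes> b \<in> J" if "a \<in> Idl A" "b \<in> B" for a b
  proof -
    have "Idl A \<subseteq> {x \<in> carrier R. \<forall>b\<in>B. x \<otimes> b \<in> J}"
      using A prod by (intro genideal_minimal colon_is_ideal J B) auto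
    then show ?thesis using that by auto
  qed
  have carr: "Idl A \<subseteq> carrier R"
    using genideal_ideal[OF A] by (rule additive_subgroup.a_subset[OF ideal.axioms(1)])
  have **: "a \<otimes> b \<in> J" if "a \<in> Idl A" "b \<in> Idl B" for a b
  proof -
    have "x \<otimes> y \<in> J" if "x \<in> B" "y \<in> Idl A" for x y
      using * that carr B m_comm by (metis subsetD)
    then have "Idl B \<subseteq> {x \<in> carrier R. \<forall>y\<in>Idl A. x \<otimes> y \<in> J}"
      using B by (intro genideal_minimal colon_is_ideal J carr) auto
    then have "b \<in> carrier R" "b \<otimes> a \<in> J" using that by auto
    then show ?thesis using that carr m_comm by (metis subsetD)
  qed
  show ?thesis
  proof
    fix s assume "s \<in> (Idl A) \<cdot> (Idl B)"
    then show "s \<in> J" by induction (auto intro: **)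
  qed
qed

section \<open>Powers of edge ideals\<close>

lemma monomial_add:
  "(monomial (a + b) :: ('v \<Rightarrow>\<^sub>0 nat) \<Rightarrow>\<^sub>0 'k::comm_ring_1) = monomial a * monomial b"
  by (simp add: monomial_eq_single mult_single)

lemma monomial_in_polynomial_ring:
  assumes "Poly_Mapping.keys a \<subseteq> V"
  shows "(monomial a :: ('v \<Rightarrow>\<^sub>0 nat) \<Rightarrow>\<^sub>0 'k::comm_ring_1) \<in> carrier (polynomial_ring V)"
  using assms by (simp add: monomial_eq_single polynomial_ring_def)

lemma var_mult_var:
  "(var i * var j :: ('v \<Rightarrow>\<^sub>0 nat) \<Rightarrow>\<^sub>0 'k::comm_ring_1) =
    monomial (Poly_Mapping.single i 1 + Poly_Mapping.single j 1)"
  by (simp add: var_def monomial_eq_single mult_single)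

lemma L_set_subset_carrier: "L_set V E t \<subseteq> carrier (polynomial_ring V)"
  by (auto simp: L_set_def monomial_in_polynomial_ring)

lemma edges_subset_carrier:
  assumes "simple_graph V E"
  shows "{var i * var j | i j. {i, j} \<in> E} \<subseteq>
    carrier (polynomial_ring V :: (('v \<Rightarrow>\<^sub>0 nat) \<Rightarrow>\<^sub>0 'k::comm_ring_1) ring)"
proof clarify
  fix i j assume "{i, j} \<in> E"
  then have "{i, j} \<subseteq> V" using assms unfolding simple_graph_def by blast
  then have "Poly_Mapping.keys (Poly_Mapping.single i (1::nat) + Poly_Mapping.single j 1) \<subseteq> V"
    using Poly_Mapping.keys_add[of "Poly_Mapping.single i (1::nat)" "Poly_Mapping.single j 1"]
    by auto
  then show "(var i * var j :: ('v \<Rightarrow>\<^sub>0 nat) \<Rightarrow>\<^sub>0 'k) \<in> carrier (polynomial_ring V)"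
    unfolding var_mult_var by (rule monomial_in_polynomial_ring)
qed

lemma edge_ideal_is_ideal:
  assumes "simple_graph V E"
  shows "ideal (edge_ideal V E :: (('v \<Rightarrow>\<^sub>0 nat) \<Rightarrow>\<^sub>0 'k::comm_ring_1) set) (polynomial_ring V)"
proof -
  interpret cring "polynomial_ring V :: (('v \<Rightarrow>\<^sub>0 nat) \<Rightarrow>\<^sub>0 'k) ring"
    by (rule cring_polynomial_ring)
  show ?thesis unfolding edge_ideal_def by (intro genideal_ideal edges_subset_carrier assms)
qed

lemma total_degree_eq_sum:
  assumes "finite V" "Poly_Mapping.keys a \<subseteq> V"
  shows "total_degree a = sum (Poly_Mapping.lookup a) V"
  unfolding total_degree_def using assms
  by (intro sum.mono_neutral_left) (auto simp: in_keys_iff)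

text \<open>An edge has degree 2 and meets every cover, so each weight rises by at least 1.\<close>

lemma L_set_mult_edge:
  assumes graph: "simple_graph V E" and e: "{i, j} \<in> E"
    and p: "(p :: ('v \<Rightarrow>\<^sub>0 nat) \<Rightarrow>\<^sub>0 'k::comm_ring_1) \<in> L_set V E t"
  shows "p * (var i * var j) \<in> L_set V E (Suc t)"
proof -
  have V: "finite V" "i \<in> V" "j \<in> V" using graph e by (auto simp: simple_graph_def)
  obtain a where a: "p = monomial a" "Poly_Mapping.keys a \<subseteq> V" "2 * t \<le> total_degree a"
    "\<And>W. minimal_vertex_cover V E W \<Longrightarrow> t \<le> vertex_weight W a"
    using p by (auto simp: L_set_def)
  define b where "b = a + (Poly_Mapping.single i 1 + Poly_Mapping.single j 1)"
  have b: "Poly_Mapping.lookup b v = Poly_Mapping.lookup a v + (if v = i then 1 else 0)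
      + (if v = j then 1 else 0)" for v
    by (simp add: b_def lookup_add lookup_single when_def)
  have keys: "Poly_Mapping.keys b \<subseteq> V"
    using V(2,3) subsetD[OF a(2)] by (auto simp: in_keys_iff b split: if_splits)
  have "total_degree b = total_degree a + 2"
    using V a(2) keys by (simp add: total_degree_eq_sum b sum.distrib)
  moreover have "Suc t \<le> vertex_weight W b" if W: "minimal_vertex_cover V E W" for W
  proof -
    have "W \<subseteq> V" "W \<inter> {i, j} \<noteq> {}"
      using W e unfolding minimal_vertex_cover_def vertex_cover_def by blast+
    moreover have "finite W" using \<open>W \<subseteq> V\<close> V(1) by (rule finite_subset)
    moreover have "t \<le> vertex_weight W a" using a(4) W .
    ultimately show ?thesis by (auto simp: vertex_weight_def b sum.distrib)
  qed
  moreover have "p * (var i * var j) = monomial b"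
    by (simp only: a(1) var_mult_var b_def monomial_add)
  ultimately show ?thesis using keys a(3) unfolding L_set_def by force
qed

lemma edge_ideal_pow_subset:
  assumes graph: "simple_graph V E"
  shows "edge_ideal V E [^]\<^bsub>ideals_set (polynomial_ring V)\<^esub> t \<subseteq>
    Idl\<^bsub>polynomial_ring V\<^esub> (L_set V E t :: (('v \<Rightarrow>\<^sub>0 nat) \<Rightarrow>\<^sub>0 'k::comm_ring_1) set)"
proof -
  define R where "R = (polynomial_ring V :: (('v \<Rightarrow>\<^sub>0 nat) \<Rightarrow>\<^sub>0 'k) ring)"
  define I where "I = (edge_ideal V E :: (('v \<Rightarrow>\<^sub>0 nat) \<Rightarrow>\<^sub>0 'k) set)"
  interpret cring R unfolding R_def by (rule cring_polynomial_ring)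
  have L: "L_set V E t \<subseteq> carrier R" for t unfolding R_def by (rule L_set_subset_carrier)
  have "I [^]\<^bsub>ideals_set R\<^esub> t \<subseteq> Idl\<^bsub>R\<^esub> (L_set V E t)"
  proof (induction t)
    case 0
    \<comment> \<open>The zeroth power is the whole ring, so 1 has to lie in the generated
      ideal.\<close>
    have "(monomial 0 :: ('v \<Rightarrow>\<^sub>0 nat) \<Rightarrow>\<^sub>0 'k) \<in> L_set V E 0"
      unfolding L_set_def by fastforce
    then have "\<one>\<^bsub>R\<^esub> \<in> L_set V E 0" by (simp add: R_def polynomial_ring_def monomial_def)
    then have "\<one>\<^bsub>R\<^esub> \<in> Idl\<^bsub>R\<^esub> (L_set V E 0)" using genideal_self[OF L] by blast
    then have "Idl\<^bsub>R\<^esub> (L_set V E 0) = carrier R"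
      using ideal.one_imp_carrier[OF genideal_ideal[OF L]] by blast
    then show ?case by (simp add: ideals_set_def)
  next
    case (Suc t)
    have "I [^]\<^bsub>ideals_set R\<^esub> Suc t = (I [^]\<^bsub>ideals_set R\<^esub> t) \<cdot>\<^bsub>R\<^esub> I"
      by (simp add: ideals_set_def)
    also have "\<dots> \<subseteq> (Idl\<^bsub>R\<^esub> (L_set V E t)) \<cdot>\<^bsub>R\<^esub> I"
    proof
      fix s assume "s \<in> (I [^]\<^bsub>ideals_set R\<^esub> t) \<cdot>\<^bsub>R\<^esub> I"
      then show "s \<in> (Idl\<^bsub>R\<^esub> (L_set V E t)) \<cdot>\<^bsub>R\<^esub> I"
        by induction (use Suc in \<open>auto intro: ideal_prod.intros\<close>)
    qed
    also have "\<dots> \<subseteq> Idl\<^bsub>R\<^esub> (L_set V E (Suc t))"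
    proof -
      have edges: "{var i * var j | i j. {i, j} \<in> E} \<subseteq> carrier R"
        unfolding R_def by (rule edges_subset_carrier[OF graph])
      have "a \<otimes>\<^bsub>R\<^esub> b \<in> Idl\<^bsub>R\<^esub> (L_set V E (Suc t))"
        if "a \<in> L_set V E t" "b \<in> {var i * var j | i j. {i, j} \<in> E}" for a b
      proof -
        have "a * b \<in> L_set V E (Suc t)"
          using that L_set_mult_edge[OF graph] by blast
        then have "a * b \<in> Idl\<^bsub>R\<^esub> (L_set V E (Suc t))" using genideal_self[OF L] by blast
        then show ?thesis by (simp add: R_def polynomial_ring_def)
      qed
      then show ?thesis unfolding I_def edge_ideal_def R_def[symmetric]
        by (intro genideal_prod_subset genideal_ideal L edges)
    qed
    finally show ?case .
  qed
  then show ?thesis by (simp add: R_def I_def)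
qed

text \<open>The family \<open>e\<close> need not be injective, so that the edges of a concrete graph can be
  enumerated without comparing them.\<close>

lemma monomial_in_edge_ideal_pow:
  fixes y :: "'j \<Rightarrow> nat" and a :: "'v \<Rightarrow>\<^sub>0 nat"
  assumes graph: "simple_graph V E" and J: "finite J" "\<And>j. j \<in> J \<Longrightarrow> e j \<in> E"
    and "Poly_Mapping.keys a \<subseteq> V" and "t \<le> sum y J"
    and "\<And>i. i \<in> V \<Longrightarrow> sum y {j \<in> J. i \<in> e j} \<le> Poly_Mapping.lookup a i"
  shows "(monomial a :: ('v \<Rightarrow>\<^sub>0 nat) \<Rightarrow>\<^sub>0 'k::comm_ring_1) \<in>
    edge_ideal V E [^]\<^bsub>ideals_set (polynomial_ring V)\<^esub> t"
  using assms(4-)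
proof (induction t arbitrary: a y)
  case 0
  then show ?case by (simp add: ideals_set_def monomial_in_polynomial_ring)
next
  case (Suc t)
  interpret cring "polynomial_ring V :: (('v \<Rightarrow>\<^sub>0 nat) \<Rightarrow>\<^sub>0 'k) ring"
    by (rule cring_polynomial_ring)
  have "sum y J \<noteq> 0" using Suc.prems(2) by simp
  then obtain l where l: "l \<in> J" "y l > 0"
    by (metis (no_types, lifting) gr0I sum.neutral)
  have "e l \<in> E" using J(2) l(1) .
  then have "card (e l) = 2" "e l \<subseteq> V" using graph by (auto simp: simple_graph_def)
  then obtain u v where uv: "e l = {u, v}" "u \<noteq> v" "u \<in> V" "v \<in> V"
    by (auto simp: card_2_iff)
  \<comment> \<open>One copy of the edge \<open>e l\<close> is split off as the factor
    \<open>monomial d\<close>; the rest is left to the induction hypothesis.\<close>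
  define y' where "y' = y(l := y l - 1)"
  have y': "sum y A = sum y' A + (if l \<in> A then 1 else 0)" if "finite A" for A
  proof -
    have "sum y A = (\<Sum>j\<in>A. y' j + (if j = l then 1 else 0))"
      using l(2) by (intro sum.cong) (auto simp: y'_def)
    then show ?thesis using that by (simp add: sum.distrib)
  qed
  define d :: "'v \<Rightarrow>\<^sub>0 nat" where "d = Poly_Mapping.single u 1 + Poly_Mapping.single v 1"
  have d: "Poly_Mapping.lookup d i = (if i \<in> e l then 1 else 0)" for i
    unfolding uv(1) d_def lookup_add lookup_single when_def using uv(2) by simp
  have bound: "sum y' {j \<in> J. i \<in> e j} + Poly_Mapping.lookup d i \<le> Poly_Mapping.lookup a i"
    if "i \<in> V" for i
    using Suc.prems(3)[OF that] y'[of "{j \<in> J. i \<in> e j}"] J(1) l(1) by (simp add: d)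
  \<comment> \<open>Subtraction of exponents is truncated, so \<open>d\<close> must be pointwise
    below \<open>a\<close>: on \<open>V\<close> by the capacity bound, elsewhere because
    \<open>d\<close> vanishes.\<close>
  have a: "a = (a - d) + d"
  proof (rule poly_mapping_eqI)
    fix i
    have "Poly_Mapping.lookup d i \<le> Poly_Mapping.lookup a i"
    proof (cases "i \<in> V")
      case True
      then show ?thesis using bound by (meson add_leE)
    next
      case False
      then have "i \<notin> e l" using \<open>e l \<subseteq> V\<close> by blast
      then show ?thesis by (simp add: d)
    qed
    then show "Poly_Mapping.lookup a i = Poly_Mapping.lookup ((a - d) + d) i"
      by (simp add: lookup_add lookup_minus)
  qed
  have "(monomial (a - d) :: ('v \<Rightarrow>\<^sub>0 nat) \<Rightarrow>\<^sub>0 'k) \<in>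
      edge_ideal V E [^]\<^bsub>ideals_set (polynomial_ring V)\<^esub> t"
  proof (rule Suc.IH[of "a - d" y'])
    show "Poly_Mapping.keys (a - d) \<subseteq> V"
      using Suc.prems(1) by (auto simp: in_keys_iff lookup_minus)
    show "t \<le> sum y' J" using Suc.prems(2) y'[OF J(1)] l(1) by simp
    show "sum y' {j \<in> J. i \<in> e j} \<le> Poly_Mapping.lookup (a - d) i" if "i \<in> V" for i
      using bound[OF that] by (simp add: lookup_minus)
  qed
  moreover have "(monomial d :: ('v \<Rightarrow>\<^sub>0 nat) \<Rightarrow>\<^sub>0 'k) \<in> edge_ideal V E"
  proof -
    have "(monomial d :: ('v \<Rightarrow>\<^sub>0 nat) \<Rightarrow>\<^sub>0 'k) \<in> {var i * var j | i j. {i, j} \<in> E}"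
      using \<open>e l \<in> E\<close> unfolding uv(1) d_def var_mult_var[symmetric] by blast
    then show ?thesis
      unfolding edge_ideal_def using genideal_self[OF edges_subset_carrier[OF graph]] by blast
  qed
  ultimately have "monomial (a - d) \<otimes>\<^bsub>polynomial_ring V\<^esub> monomial d \<in>
      (edge_ideal V E [^]\<^bsub>ideals_set (polynomial_ring V)\<^esub> t)
        \<cdot>\<^bsub>polynomial_ring V\<^esub> (edge_ideal V E :: (('v \<Rightarrow>\<^sub>0 nat) \<Rightarrow>\<^sub>0 'k) set)"
    by (rule ideal_prod.prod)
  moreover have "(monomial a :: ('v \<Rightarrow>\<^sub>0 nat) \<Rightarrow>\<^sub>0 'k) = monomial (a - d) * monomial d"
    by (metis a monomial_add)
  ultimately show ?case by (simp add: polynomial_ring_def ideals_set_def)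
qed

text \<open>The exponents act as vertex capacities: the conditions of \<open>L_set\<close> yield a
  multiset of edges by \<open>cycle_matching\<close>, and its product divides the monomial.\<close>

lemma L_set_cycle_subset:
  assumes m: "m \<ge> 3"
  shows "(L_set (cycle_vertices m) (cycle_edges m) t :: ((nat \<Rightarrow>\<^sub>0 nat) \<Rightarrow>\<^sub>0 'k::comm_ring_1) set) \<subseteq>
    edge_ideal (cycle_vertices m) (cycle_edges m)
      [^]\<^bsub>ideals_set (polynomial_ring (cycle_vertices m))\<^esub> t"
proof
  let ?V = "cycle_vertices m" and ?E = "cycle_edges m"
  have V: "finite ?V" by (simp add: cycle_vertices_def)
  fix p :: "(nat \<Rightarrow>\<^sub>0 nat) \<Rightarrow>\<^sub>0 'k"
  assume "p \<in> L_set ?V ?E t"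
  then obtain a where a: "p = monomial a" "Poly_Mapping.keys a \<subseteq> ?V" "2 * t \<le> total_degree a"
    "\<And>W. minimal_vertex_cover ?V ?E W \<Longrightarrow> t \<le> vertex_weight W a"
    by (auto simp: L_set_def)
  have deg: "2 * t \<le> sum (Poly_Mapping.lookup a) {1..m}"
    using a(3) total_degree_eq_sum[OF V a(2)] by (simp add: cycle_vertices_def)
  have cover: "t \<le> sum (Poly_Mapping.lookup a) U" if "path_cover m U" "1 \<in> U \<or> m \<in> U" for U
  proof -
    have "vertex_cover ?V ?E U"
      using that by (auto simp: vertex_cover_def path_cover_def cycle_vertices_def cycle_edges_def)
    then obtain W where W: "minimal_vertex_cover ?V ?E W" "W \<subseteq> U"
      using minimal_vertex_cover_subset[OF V] by blast
    have "t \<le> sum (Poly_Mapping.lookup a) W" using a(4)[OF W(1)] by (simp add: vertex_weight_def)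
    also have "\<dots> \<le> sum (Poly_Mapping.lookup a) U"
      using W(2) path_cover_finite[OF that(1)] by (intro sum_mono2) auto
    finally show ?thesis .
  qed
  obtain y where y: "t \<le> sum y {1..m}"
    "\<forall>i\<in>{1..m}. y i + y (if i = 1 then m else i - 1) \<le> Poly_Mapping.lookup a i"
    using cycle_matching[OF m deg cover] by blast
  define e where "e j = {j, if j = m then 1 else j + 1}" for j
  have "monomial a \<in> edge_ideal ?V ?E [^]\<^bsub>ideals_set (polynomial_ring ?V)\<^esub> t"
  proof (rule monomial_in_edge_ideal_pow[where J = "{1..m}" and e = e and y = y])
    show "simple_graph ?V ?E" using m by (rule simple_graph_cycle)
    show "e j \<in> ?E" if "j \<in> {1..m}" for j
      using that by (cases "j = m") (auto simp: e_def cycle_edges_def)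
    fix i assume "i \<in> ?V"
    then have i: "i \<in> {1..m}" by (simp add: cycle_vertices_def)
    \<comment> \<open>Vertex \<open>i\<close> lies on the edges indexed by itself and by its cyclic
      predecessor. These indices differ, so the sum has two terms.\<close>
    have "{j \<in> {1..m}. i \<in> e j} = {i, if i = 1 then m else i - 1}"
      using i m by (auto simp: e_def split: if_splits)
    moreover have "i \<noteq> (if i = 1 then m else i - 1)" using i m by auto
    ultimately have "sum y {j \<in> {1..m}. i \<in> e j} = y i + y (if i = 1 then m else i - 1)"
      by simp
    then show "sum y {j \<in> {1..m}. i \<in> e j} \<le> Poly_Mapping.lookup a i" using y(2) i by simp
  qed (use a(2) y(1) in auto)
  then show "p \<in> edge_ideal ?V ?E [^]\<^bsub>ideals_set (polynomial_ring ?V)\<^esub> t" by (simp add: a(1))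
qed

theorem theorem4p4:
  fixes n t :: nat
    and V :: "nat set" and E :: "nat set set"
    and R :: "((nat \<Rightarrow>\<^sub>0 nat) \<Rightarrow>\<^sub>0 'k::alg_closed_field) ring"
  assumes "n \<ge> 1" and "t \<ge> 1"
    and "V = cycle_vertices (2 * n + 1)" and "E = cycle_edges (2 * n + 1)"
    and "R = polynomial_ring V"
  shows "edge_ideal V E [^]\<^bsub>ideals_set R\<^esub> t = Idl\<^bsub>R\<^esub> (L_set V E t)"
proof -
  interpret cring R unfolding assms(5) by (rule cring_polynomial_ring)
  have m: "2 * n + 1 \<ge> 3" using assms(1) by simp
  have graph: "simple_graph V E" unfolding assms(3,4) using m by (rule simple_graph_cycle)
  show ?thesis
  proof
    show "edge_ideal V E [^]\<^bsub>ideals_set R\<^esub> t \<subseteq> Idl\<^bsub>R\<^esub> (L_set V E t)"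
      unfolding assms(5) using graph by (rule edge_ideal_pow_subset)
    have I: "ideal (edge_ideal V E) R"
      unfolding assms(5) using graph by (rule edge_ideal_is_ideal)
    have "L_set V E t \<subseteq> edge_ideal V E [^]\<^bsub>ideals_set R\<^esub> t"
      unfolding assms(3-5) using m by (rule L_set_cycle_subset)
    then show "Idl\<^bsub>R\<^esub> (L_set V E t) \<subseteq> edge_ideal V E [^]\<^bsub>ideals_set R\<^esub> t"
      by (rule genideal_minimal[OF ideal_pow_is_ideal[OF I]])
  qed
qed

end
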